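(* Let $I\subset\mathbb{R}$ be an open interval and let $\Sigma\subset\mathbb{R}^2$ be a smooth embedded curve in the $(v,r_v)$-plane, parametrized by $t\mapsto(\mathcal{T}(t),\mathcal{R}(t))$, $t\in I$. Prescribing $M$ and finitely many of its partial derivatives on $\Sigma$ does not uniquely determine the function $M(v,r_v)$ in any neighborhood of $\Sigma$. That is: for every integer $N\ge 0$ and every smooth ($C^\infty$) real-valued function $M(v,r_v)$ defined on an open neighborhood of $\Sigma$, there is a smooth function $\widetilde M(v,r_v)$ defined on an open neighborhood of $\Sigma$ such that $$\left.\partial_v^p\partial_{r_v}^q\widetilde M\right|_\Sigma=\left.\partial_v^p\partial_{r_v}^q M\right|_\Sigma\qquad\text{for all integers }p,q\ge 0\text{ with }p+q\le N,$$ and such that $\widetilde M\neq M$ (as functions) on every neighborhood of $\Sigma$ contained in both domains.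
   Context: In the application, $M(v,r_v)$ is the mass function of the generalized Vaidya metric $ds^2=-(1-2M(v,r_v)/r_v)\,dv^2+2\,dv\,dr_v+r_v^2\,d\Omega^2$, and $\Sigma$ is the trace in the $(v,r_v)$-plane of the hypersurface across which this metric is matched to an interior spacetime. Only the fact that $\Sigma$ is a smooth embedded curve is used in the statement. *)

theory Defs
  imports "HOL-Analysis.Analysis"
begin

definition partial_v :: "(real \<times> real \<Rightarrow> real) \<Rightarrow> real \<times> real \<Rightarrow> real"
  where "partial_v f = (\<lambda>(v, r). deriv (\<lambda>x. f (x, r)) v)"

definition partial_r :: "(real \<times> real \<Rightarrow> real) \<Rightarrow> real \<times> real \<Rightarrow> real"
  where "partial_r f = (\<lambda>(v, r). deriv (\<lambda>y. f (v, y)) r)"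

(* Functions on an open set U are represented by total functions. Differentiability is required
   explicitly because deriv returns an unspecified value where no derivative exists. *)
primrec Ck_on :: "nat \<Rightarrow> (real \<times> real) set \<Rightarrow> (real \<times> real \<Rightarrow> real) \<Rightarrow> bool" where
  "Ck_on 0 U f \<longleftrightarrow> continuous_on U f"
| "Ck_on (Suc k) U f \<longleftrightarrow>
     continuous_on U f \<and>
     (\<forall>(v, r) \<in> U. (\<lambda>x. f (x, r)) differentiable (at v) \<and>
                   (\<lambda>y. f (v, y)) differentiable (at r)) \<and>
     Ck_on k U (partial_v f) \<and> Ck_on k U (partial_r f)"

definition smooth_on_plane :: "(real \<times> real) set \<Rightarrow> (real \<times> real \<Rightarrow> real) \<Rightarrow> bool"
  where "smooth_on_plane U f \<longleftrightarrow> (\<forall>k. Ck_on k U f)"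

definition smooth_on_line :: "real set \<Rightarrow> (real \<Rightarrow> real) \<Rightarrow> bool"
  where "smooth_on_line I f \<longleftrightarrow> (\<forall>n. \<forall>t\<in>I. (deriv ^^ n) f differentiable (at t))"

(* A smooth immersion that is a homeomorphism onto its image with the subspace topology;
   the image need not be closed in the plane. *)
definition smooth_embedded_curve :: "real set \<Rightarrow> (real \<Rightarrow> real) \<Rightarrow> (real \<Rightarrow> real) \<Rightarrow> bool"
  where "smooth_embedded_curve I T R \<longleftrightarrow>
     smooth_on_line I T \<and> smooth_on_line I R \<and>
     (\<forall>t\<in>I. (deriv T t, deriv R t) \<noteq> (0, 0)) \<and>
     embedding_map (top_of_set I) euclidean (\<lambda>t. (T t, R t))"

end

theory Submission
  imports Defs
begin

text \<open>
  Write the complement of the closure of \<open>\<Sigma>\<close> as a countable union of open boxes, choose on each box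
  a product of two bump functions of one variable, and add these products up with weights so small
  that every termwise differentiated series converges uniformly. The sum \<open>h\<close> is smooth, vanishes
  with all its derivatives on the closure of \<open>\<Sigma>\<close>, and is positive everywhere else; take
  \<open>M + h\<close>. An embedded curve is locally compact, hence relatively closed in an open set, and it is
  a null set; so its closure contains no open set that meets \<open>\<Sigma>\<close>, and \<open>h\<close> does not vanish
  identically on any neighbourhood of \<open>\<Sigma>\<close>.
\<close>

section \<open>Bump functions on the line\<close>

text \<open>For \<open>P = 1\<close> this is the classical smooth non-analytic function
  \<open>exp (- 1 / x)\<close>. Allowing a polynomial in \<open>1 / x\<close> as a factor makes the
  family closed under differentiation.\<close>

definition flat_exp :: "real poly \<Rightarrow> real \<Rightarrow> real"
  where "flat_exp P x = (if x > 0 then poly P (1 / x) * exp (- (1 / x)) else 0)"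

lemma tendsto_poly_div_exp:
  fixes P :: "real poly"
  shows "((\<lambda>y. poly P y * exp (- y)) \<longlongrightarrow> 0) at_top"
proof -
  have "((\<lambda>y. \<Sum>i\<le>degree P. coeff P i * (y ^ i / exp y)) \<longlongrightarrow> (\<Sum>i\<le>degree P. coeff P i * 0)) at_top"
    by (intro tendsto_sum tendsto_mult tendsto_const tendsto_power_div_exp_0)
  moreover have "(\<lambda>y. poly P y * exp (- y)) = (\<lambda>y. \<Sum>i\<le>degree P. coeff P i * (y ^ i / exp y))"
    by (simp add: poly_altdef sum_distrib_right exp_minus divide_inverse mult.assoc)
  ultimately show ?thesis by simp
qed

text \<open>From the right, substituting \<open>y = 1 / x\<close> turns this into the decay of
  \<open>poly P y * exp (- y)\<close> at infinity; from the left the function is constantly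
  0.\<close>

lemma flat_exp_tendsto_0: "(flat_exp P \<longlongrightarrow> 0) (at 0)"
proof (rule filterlim_split_at)
  have "((\<lambda>x. poly P (inverse x) * exp (- inverse x)) \<longlongrightarrow> 0) (at_right 0)"
    by (rule filterlim_compose[OF tendsto_poly_div_exp filterlim_inverse_at_top_right])
  then show "(flat_exp P \<longlongrightarrow> 0) (at_right 0)"
    by (rule Lim_transform_eventually)
      (auto simp: flat_exp_def eventually_at_filter inverse_eq_divide)
  show "(flat_exp P \<longlongrightarrow> 0) (at_left 0)"
    by (rule Lim_transform_eventually[OF tendsto_const])
      (auto simp: flat_exp_def eventually_at_filter)
qed

text \<open>With \<open>y = 1 / x\<close> one has \<open>dy/dx = - y^2\<close>, so
  \<open>P(y) exp(-y)\<close> has derivative \<open>y^2 (P - P')(y) exp(-y)\<close>; the factor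
  \<open>[:0, 0, 1:]\<close> is \<open>y^2\<close>.\<close>

lemma flat_exp_has_derivative:
  "(flat_exp P has_real_derivative flat_exp ([:0, 0, 1:] * (P - pderiv P)) x) (at x)"
proof (cases x "0 :: real" rule: linorder_cases)
  case less
  have "((\<lambda>_. 0) has_real_derivative 0) (at x)" by simp
  then have "(flat_exp P has_real_derivative 0) (at x)"
    by (rule has_field_derivative_transform_within_open[where S = "{..<0}"])
      (use less in \<open>auto simp: flat_exp_def\<close>)
  with less show ?thesis by (simp add: flat_exp_def)
next
  case equal
  \<comment> \<open>Dividing by \<open>h\<close> raises the degree in \<open>1 / h\<close> by one,
    so the difference quotient at 0 is itself \<open>flat_exp (pCons 0 P)\<close>, whose limit is
    already known.\<close>
  have "((\<lambda>h. (flat_exp P (0 + h) - flat_exp P 0) / h) \<longlongrightarrow> 0) (at 0)"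
    by (rule Lim_transform_eventually[OF flat_exp_tendsto_0[of "pCons 0 P"]])
      (auto simp: flat_exp_def eventually_at_filter)
  with equal show ?thesis
    by (simp add: DERIV_def flat_exp_def)
next
  case greater
  have "((\<lambda>y. poly P (1 / y) * exp (- (1 / y))) has_real_derivative
      flat_exp ([:0, 0, 1:] * (P - pderiv P)) x) (at x)"
    using greater
    by (auto intro!: derivative_eq_intros DERIV_chain'[OF _ poly_DERIV]
        simp: flat_exp_def field_simps power2_eq_square)
  then show ?thesis
    by (rule has_field_derivative_transform_within_open[where S = "{0<..}"])
      (use greater in \<open>auto simp: flat_exp_def\<close>)
qed

text \<open>
  Being closed under differentiation, this space contains all derivatives of its members, so their
  support and boundedness need no explicit formula for the derivatives.
\<close>

inductive_set bump_space :: "real \<Rightarrow> real \<Rightarrow> (real \<Rightarrow> real) set" for a b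
  where
    prod: "(\<lambda>x. flat_exp P (x - a) * flat_exp Q (b - x)) \<in> bump_space a b"
  | add: "f \<in> bump_space a b \<Longrightarrow> g \<in> bump_space a b \<Longrightarrow> (\<lambda>x. f x + g x) \<in> bump_space a b"

lemma flat_exp_uminus: "flat_exp (- P) x = - flat_exp P x"
  by (simp add: flat_exp_def)

lemma bump_space_has_derivative:
  assumes "f \<in> bump_space a b"
  shows "\<exists>f'\<in>bump_space a b. \<forall>x. (f has_real_derivative f' x) (at x)"
  using assms
proof induction
  case (prod P Q)
  let ?D = "\<lambda>P :: real poly. [:0, 0, 1:] * (P - pderiv P)"
  \<comment> \<open>The minus sign from differentiating \<open>b - x\<close> is moved into the
    polynomial, so that both summands are generators of \<open>bump_space\<close>.\<close>
  let ?f' = "\<lambda>x. flat_exp (?D P) (x - a) * flat_exp Q (b - x) +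
     flat_exp P (x - a) * flat_exp (- ?D Q) (b - x)"
  have 1: "((\<lambda>x. flat_exp P (x - a)) has_real_derivative flat_exp (?D P) (x - a)) (at x)" for x
    using DERIV_shift[of "flat_exp P" _ x "- a"] flat_exp_has_derivative[of P "x - a"] by simp
  have 2: "((\<lambda>x. flat_exp Q (b - x)) has_real_derivative flat_exp (- ?D Q) (b - x)) (at x)" for x
  proof -
    have "((\<lambda>x. b - x) has_real_derivative - 1) (at x)" by (auto intro!: derivative_eq_intros)
    from DERIV_chain2[where f = "flat_exp Q", OF flat_exp_has_derivative this]
    show ?thesis by (simp add: flat_exp_uminus del: mult_pCons_left)
  qed
  have "\<forall>x. ((\<lambda>x. flat_exp P (x - a) * flat_exp Q (b - x)) has_real_derivative ?f' x) (at x)"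
    using DERIV_mult[OF 1 2] by (simp add: algebra_simps del: mult_pCons_left)
  moreover have "?f' \<in> bump_space a b"
    by (intro bump_space.intros)
  ultimately show ?case by (intro bexI[of _ ?f']) simp_all
next
  case (add f g)
  then obtain f' g' where "f' \<in> bump_space a b" "\<forall>x. (f has_real_derivative f' x) (at x)"
    "g' \<in> bump_space a b" "\<forall>x. (g has_real_derivative g' x) (at x)" by blast
  then show ?case
    by (intro bexI[of _ "\<lambda>x. f' x + g' x"]) (auto intro: bump_space.add DERIV_add)
qed

lemma bump_space_eq_0:
  assumes "f \<in> bump_space a b" "x \<notin> {a<..<b}"
  shows "f x = 0"
  using assms by induction (auto simp: flat_exp_def)

lemma bump_space_bounded:
  assumes "f \<in> bump_space a b"
  shows "\<exists>B. \<forall>x. \<bar>f x\<bar> \<le> B"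
proof -
  have "continuous_on {a..b} f"
    using bump_space_has_derivative[OF assms]
    by (metis DERIV_continuous_on has_field_derivative_at_within)
  then have "bounded (f ` {a..b})"
    by (intro compact_imp_bounded compact_continuous_image) auto
  then obtain B where B: "\<forall>y\<in>f ` {a..b}. norm y \<le> B" by (auto simp: bounded_iff)
  \<comment> \<open>The maximum covers points outside the interval, and also an empty
    \<open>{a..b}\<close>, where \<open>B\<close> could be negative.\<close>
  have "\<bar>f x\<bar> \<le> max B 0" for x
  proof (cases "x \<in> {a<..<b}")
    case True
    then have "norm (f x) \<le> B" using B by simp
    then show ?thesis by simp
  next
    case False then show ?thesis using bump_space_eq_0[OF assms] by simp
  qed
  then show ?thesis by blast
qed

definition bump :: "real \<Rightarrow> real \<Rightarrow> real \<Rightarrow> real"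
  where "bump a b x = flat_exp 1 (x - a) * flat_exp 1 (b - x)"

lemma bump_pos: "x \<in> {a<..<b} \<Longrightarrow> bump a b x > 0"
  by (simp add: bump_def flat_exp_def)

lemma higher_deriv_bump_space: "(deriv ^^ k) (bump a b) \<in> bump_space a b"
proof (induction k)
  case 0
  show ?case using bump_space.prod[of 1 a 1 b] by (simp add: bump_def[abs_def])
next
  case (Suc k)
  obtain f' where "f' \<in> bump_space a b" "\<forall>x. ((deriv ^^ k) (bump a b) has_real_derivative f' x) (at x)"
    using bump_space_has_derivative[OF Suc] by blast
  moreover from this have "f' = deriv ((deriv ^^ k) (bump a b))"
    by (metis DERIV_imp_deriv ext)
  ultimately show ?case by simp
qed

lemma higher_deriv_bump:
  "((deriv ^^ k) (bump a b) has_real_derivative (deriv ^^ Suc k) (bump a b) x) (at x)"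
proof -
  obtain f' where "\<forall>x. ((deriv ^^ k) (bump a b) has_real_derivative f' x) (at x)"
    using bump_space_has_derivative[OF higher_deriv_bump_space] by blast
  moreover from this have "deriv ((deriv ^^ k) (bump a b)) x = f' x"
    by (simp add: DERIV_imp_deriv)
  ultimately show ?thesis by simp
qed

section \<open>Calculus of functions on the plane\<close>

lemma eventually_slices:
  fixes U :: "(real \<times> real) set"
  assumes "open U" "(v, r) \<in> U"
  shows "\<forall>\<^sub>F x in nhds v. (x, r) \<in> U" "\<forall>\<^sub>F y in nhds r. (v, y) \<in> U"
proof -
  obtain A B where "open A" "open B" "v \<in> A" "r \<in> B" "A \<times> B \<subseteq> U"
    using assms by (metis open_prod_elim mem_Times_iff fst_conv snd_conv)
  then show "\<forall>\<^sub>F x in nhds v. (x, r) \<in> U" "\<forall>\<^sub>F y in nhds r. (v, y) \<in> U"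
    by (auto simp: eventually_nhds)
qed

text \<open>Partial derivatives are local: near a point of the open set \<open>U\<close>, both
  coordinate slices stay inside \<open>U\<close>.\<close>

lemma partial_cong:
  assumes "open U" "\<And>x. x \<in> U \<Longrightarrow> f x = g x" "x \<in> U"
  shows "partial_v f x = partial_v g x" "partial_r f x = partial_r g x"
proof -
  obtain v r where x: "x = (v, r)" by fastforce
  note ev = eventually_slices[OF assms(1) assms(3)[unfolded x]]
  have "\<forall>\<^sub>F x in nhds v. f (x, r) = g (x, r)"
    using ev(1) by eventually_elim (rule assms(2))
  then show "partial_v f x = partial_v g x"
    unfolding x partial_v_def prod.case by (rule deriv_cong_ev) (rule refl)
  have "\<forall>\<^sub>F y in nhds r. f (v, y) = g (v, y)"
    using ev(2) by eventually_elim (rule assms(2))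
  then show "partial_r f x = partial_r g x"
    unfolding x partial_r_def prod.case by (rule deriv_cong_ev) (rule refl)
qed

lemma partial_add:
  assumes "Ck_on (Suc k) U f" "Ck_on (Suc l) U g" "x \<in> U"
  shows "partial_v (\<lambda>x. f x + g x) x = partial_v f x + partial_v g x"
    "partial_r (\<lambda>x. f x + g x) x = partial_r f x + partial_r g x"
proof -
  obtain v r where x: "x = (v, r)" by fastforce
  have "(\<lambda>x. f (x, r)) differentiable (at v)" "(\<lambda>y. f (v, y)) differentiable (at r)"
    "(\<lambda>x. g (x, r)) differentiable (at v)" "(\<lambda>y. g (v, y)) differentiable (at r)"
    using assms x by auto
  note D = this[folded DERIV_deriv_iff_real_differentiable]
  show "partial_v (\<lambda>x. f x + g x) x = partial_v f x + partial_v g x"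
    using DERIV_imp_deriv[OF DERIV_add[OF D(1,3)]] by (simp add: x partial_v_def)
  show "partial_r (\<lambda>x. f x + g x) x = partial_r f x + partial_r g x"
    using DERIV_imp_deriv[OF DERIV_add[OF D(2,4)]] by (simp add: x partial_r_def)
qed

text \<open>Functions are total but identities such as \<open>partial_add\<close> hold only on
  \<open>U\<close>. This lemma lets the recursion of \<open>Ck_on\<close> pass through them.\<close>

lemma Ck_on_cong:
  assumes "open U" "\<And>x. x \<in> U \<Longrightarrow> f x = g x" "Ck_on k U f"
  shows "Ck_on k U g"
  using assms(2,3)
proof (induction k arbitrary: f g)
  case 0
  then show ?case using continuous_on_eq by auto
next
  case (Suc k)
  have "(\<lambda>x. g (x, r)) differentiable (at v) \<and> (\<lambda>y. g (v, y)) differentiable (at r)"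
    if "(v, r) \<in> U" for v r
  proof -
    note ev = eventually_slices[OF assms(1) that]
    obtain A where A: "open A" "v \<in> A" "\<And>x. x \<in> A \<Longrightarrow> (x, r) \<in> U"
      using ev(1) by (auto simp: eventually_nhds)
    obtain B where B: "open B" "r \<in> B" "\<And>x. x \<in> B \<Longrightarrow> (v, x) \<in> U"
      using ev(2) by (auto simp: eventually_nhds)
    from Suc.prems(2) that obtain D E
      where "((\<lambda>x. f (x, r)) has_real_derivative D) (at v)"
        "((\<lambda>y. f (v, y)) has_real_derivative E) (at r)"
      by (auto simp: real_differentiable_def)
    from has_field_derivative_transform_within_open[OF this(1) A(1,2), of "\<lambda>x. g (x, r)"]
      has_field_derivative_transform_within_open[OF this(2) B(1,2), of "\<lambda>y. g (v, y)"]
    have "((\<lambda>x. g (x, r)) has_real_derivative D) (at v)"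
        "((\<lambda>y. g (v, y)) has_real_derivative E) (at r)"
      using A(3) B(3) Suc.prems(1) by auto
    then show ?thesis by (auto simp: real_differentiable_def)
  qed
  moreover have "continuous_on U g"
    using Suc.prems continuous_on_eq by auto
  moreover have "Ck_on k U (partial_v g)"
    by (rule Suc.IH[OF partial_cong(1)[OF assms(1) Suc.prems(1)]]) (use Suc.prems(2) in auto)
  moreover have "Ck_on k U (partial_r g)"
    by (rule Suc.IH[OF partial_cong(2)[OF assms(1) Suc.prems(1)]]) (use Suc.prems(2) in auto)
  ultimately show ?case by auto
qed

lemma Ck_on_add:
  assumes "open U" "Ck_on k U f" "Ck_on k U g"
  shows "Ck_on k U (\<lambda>x. f x + g x)"
  using assms(2,3)
proof (induction k arbitrary: f g)
  case 0
  then show ?case by (auto intro: continuous_on_add)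
next
  case (Suc k)
  have "Ck_on k U (partial_v (\<lambda>x. f x + g x))"
    by (rule Ck_on_cong[OF assms(1) partial_add(1)[symmetric, OF Suc.prems]])
      (use Suc in auto)
  moreover have "Ck_on k U (partial_r (\<lambda>x. f x + g x))"
    by (rule Ck_on_cong[OF assms(1) partial_add(2)[symmetric, OF Suc.prems]])
      (use Suc in auto)
  ultimately show ?case
    using Suc.prems by (auto intro!: continuous_on_add differentiable_add)
qed

lemma Ck_on_subset: "Ck_on k V f \<Longrightarrow> U \<subseteq> V \<Longrightarrow> Ck_on k U f"
  by (induction k arbitrary: f) (auto intro: continuous_on_subset)

lemma smooth_on_plane_partial:
  assumes "smooth_on_plane U f"
  shows "smooth_on_plane U (partial_v f)" "smooth_on_plane U (partial_r f)"
  using assms by (metis Ck_on.simps(2) smooth_on_plane_def)+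

lemma smooth_on_plane_funpow:
  assumes "smooth_on_plane U f"
  shows "smooth_on_plane U ((partial_v ^^ p) f)" "smooth_on_plane U ((partial_r ^^ p) f)"
  using assms by (induction p) (auto intro: smooth_on_plane_partial)

text \<open>The function \<open>h\<close> is only required to agree with the sum on
  \<open>U\<close>. Hence the \<open>partial_v\<close> part can be applied after the
  \<open>partial_r\<close> part, whose result is a sum only there.\<close>

lemma funpow_partial_add:
  assumes "open U" "smooth_on_plane U f" "smooth_on_plane U g" "\<And>x. x \<in> U \<Longrightarrow> h x = f x + g x"
    and "x \<in> U"
  shows "(partial_v ^^ p) h x = (partial_v ^^ p) f x + (partial_v ^^ p) g x"
    "(partial_r ^^ p) h x = (partial_r ^^ p) f x + (partial_r ^^ p) g x"
proof -
  have "\<forall>x\<in>U. (partial_v ^^ p) h x = (partial_v ^^ p) f x + (partial_v ^^ p) g x"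
  proof (induction p)
    case (Suc p)
    show ?case
    proof
      fix x assume x: "x \<in> U"
      have "partial_v ((partial_v ^^ p) h) x =
          partial_v (\<lambda>x. (partial_v ^^ p) f x + (partial_v ^^ p) g x) x"
        by (rule partial_cong[OF assms(1) _ x]) (use Suc in auto)
      also have "\<dots> = partial_v ((partial_v ^^ p) f) x + partial_v ((partial_v ^^ p) g) x"
        using smooth_on_plane_funpow(1) assms(2,3) x
        by (intro partial_add(1)[of 0 U _ 0]) (auto simp: smooth_on_plane_def simp del: Ck_on.simps)
      finally show "(partial_v ^^ Suc p) h x = (partial_v ^^ Suc p) f x + (partial_v ^^ Suc p) g x"
        by simp
    qed
  qed (use assms in auto)
  then show "(partial_v ^^ p) h x = (partial_v ^^ p) f x + (partial_v ^^ p) g x"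
    using assms by auto
  have "\<forall>x\<in>U. (partial_r ^^ p) h x = (partial_r ^^ p) f x + (partial_r ^^ p) g x"
  proof (induction p)
    case (Suc p)
    show ?case
    proof
      fix x assume x: "x \<in> U"
      have "partial_r ((partial_r ^^ p) h) x =
          partial_r (\<lambda>x. (partial_r ^^ p) f x + (partial_r ^^ p) g x) x"
        by (rule partial_cong[OF assms(1) _ x]) (use Suc in auto)
      also have "\<dots> = partial_r ((partial_r ^^ p) f) x + partial_r ((partial_r ^^ p) g) x"
        using smooth_on_plane_funpow(2) assms(2,3) x
        by (intro partial_add(2)[of 0 U _ 0]) (auto simp: smooth_on_plane_def simp del: Ck_on.simps)
      finally show "(partial_r ^^ Suc p) h x = (partial_r ^^ Suc p) f x + (partial_r ^^ Suc p) g x"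
        by simp
    qed
  qed (use assms in auto)
  then show "(partial_r ^^ p) h x = (partial_r ^^ p) f x + (partial_r ^^ p) g x"
    using assms by auto
qed

section \<open>Smooth functions vanishing to infinite order exactly on a closed set\<close>

text \<open>\<open>S p q\<close> is a candidate for the mixed partial of order
  \<open>(p, q)\<close>. Working with the whole array at once makes \<open>Ck_on\<close> a plain
  induction on \<open>k\<close>, because each partial of a member is again a member.\<close>

lemma smooth_of_all_partials:
  assumes "\<And>p q. continuous_on UNIV (S p q)"
    and "\<And>p q v r. ((\<lambda>x. S p q (x, r)) has_real_derivative S (Suc p) q (v, r)) (at v)"
    and "\<And>p q v r. ((\<lambda>y. S p q (v, y)) has_real_derivative S p (Suc q) (v, r)) (at r)"
  shows "smooth_on_plane UNIV (S 0 0)"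
    and "(partial_v ^^ p) ((partial_r ^^ q) (S 0 0)) = S p q"
proof -
  have pv: "partial_v (S p q) = S (Suc p) q" for p q
    by (auto simp: partial_v_def fun_eq_iff intro!: DERIV_imp_deriv assms(2))
  have pr: "partial_r (S p q) = S p (Suc q)" for p q
    by (auto simp: partial_r_def fun_eq_iff intro!: DERIV_imp_deriv assms(3))
  have "(\<lambda>x. S p q (x, r)) differentiable (at v)" "(\<lambda>y. S p q (v, y)) differentiable (at r)"
    for p q v r
    using assms(2,3) real_differentiable_def by blast+
  then have "Ck_on k UNIV (S p q)" for k p q
    by (induction k arbitrary: p q) (use assms(1) in \<open>auto simp: pv pr\<close>)
  then show "smooth_on_plane UNIV (S 0 0)" by (simp add: smooth_on_plane_def)
  have "(partial_r ^^ q) (S 0 0) = S 0 q" by (induction q) (auto simp: pr)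
  moreover have "(partial_v ^^ p) (S 0 q) = S p q" by (induction p) (auto simp: pv)
  ultimately show "(partial_v ^^ p) ((partial_r ^^ q) (S 0 0)) = S p q" by simp
qed

text \<open>A diagonal choice: the weight of the \<open>n\<close>-th term controls only the finitely
  many orders up to \<open>n\<close>. Any fixed order is then controlled in all but finitely many
  terms, which suffices for convergence.\<close>

lemma uniform_weight:
  fixes F :: "nat \<Rightarrow> nat \<Rightarrow> 'a \<Rightarrow> real"
  assumes "\<And>p q. \<exists>B. \<forall>x. \<bar>F p q x\<bar> \<le> B"
  shows "\<exists>c>0. \<forall>p\<le>n. \<forall>q\<le>n. \<forall>x. \<bar>c * F p q x\<bar> \<le> (1 / 2) ^ n"
proof -
  obtain B where B: "\<And>p q x. \<bar>F p q x\<bar> \<le> B p q" using assms by metis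
  \<comment> \<open>The sum dominates each \<open>B p q\<close> in range; adding 1 makes
    \<open>K\<close> positive, so that \<open>(1 / 2) ^ n / K\<close> is an admissible
    weight.\<close>
  define K where "K = 1 + (\<Sum>p\<le>n. \<Sum>q\<le>n. B p q)"
  have nonneg: "B p q \<ge> 0" for p q using B[of p q] by (meson abs_ge_zero order_trans)
  then have K: "K > 0" by (simp add: K_def add_pos_nonneg sum_nonneg)
  have "B p q \<le> K" if "p \<le> n" "q \<le> n" for p q
  proof -
    have "B p q \<le> (\<Sum>q\<le>n. B p q)"
      by (rule member_le_sum) (use that nonneg in auto)
    also have "\<dots> \<le> (\<Sum>p\<le>n. \<Sum>q\<le>n. B p q)"
      by (rule member_le_sum[where f = "\<lambda>p. \<Sum>q\<le>n. B p q"]) (use that nonneg in \<open>auto intro: sum_nonneg\<close>)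
    finally show ?thesis by (simp add: K_def)
  qed
  then have "\<bar>F p q x\<bar> \<le> K" if "p \<le> n" "q \<le> n" for p q x
    using that B order_trans by blast
  then show ?thesis using K
    by (intro exI[of _ "(1 / 2) ^ n / K"]) (auto simp: abs_mult field_simps)
qed

lemma flat_function_exists:
  fixes Z :: "(real \<times> real) set"
  assumes "closed Z"
  obtains h where "smooth_on_plane UNIV h" "\<And>x. x \<notin> Z \<Longrightarrow> h x > 0"
    "\<And>p q x. x \<in> Z \<Longrightarrow> (partial_v ^^ p) ((partial_r ^^ q) h) x = 0"
proof -
  obtain D where D: "countable D" "D \<subseteq> Pow (- Z)" "\<And>X. X \<in> D \<Longrightarrow> \<exists>a b. X = box a b" "\<Union>D = - Z"
    using open_countable_Union_open_box[of "- Z"] assms by blast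
  \<comment> \<open>Adding the empty box leaves the union unchanged and permits an enumeration by
    all naturals even when \<open>D\<close> is empty, that is, when \<open>Z\<close> is the whole
    plane.\<close>
  have D': "countable (insert {} D)" "insert {} D \<noteq> {}" using D by auto
  have "\<exists>a b. from_nat_into (insert {} D) n = box a b" for n
    using from_nat_into[OF D'(2), of n] D(3) box_idem by (metis insert_iff)
  then obtain a b where ab: "\<And>n. from_nat_into (insert {} D) n = box (a n) (b n)" by metis
  have Un: "(\<Union>n. box (a n) (b n)) = - Z"
  proof -
    have "range (\<lambda>n. box (a n) (b n)) = insert {} D"
      using range_from_nat_into[OF D'(2,1)] ab by simp
    then show ?thesis using D(4) by simp
  qed
  define f where "f n = bump (fst (a n)) (fst (b n))" for n
  define g where "g n = bump (snd (a n)) (snd (b n))" for n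
  \<comment> \<open>The mixed partial of order \<open>(p, q)\<close> of the product bump on the
    \<open>n\<close>-th box; since the variables are separated, each derivative acts on one
    factor.\<close>
  define F where "F n p q x = (deriv ^^ p) (f n) (fst x) * (deriv ^^ q) (g n) (snd x)" for n p q x
  have "\<exists>B. \<forall>x. \<bar>F n p q x\<bar> \<le> B" for n p q
  proof -
    obtain A B where A: "\<And>x. \<bar>(deriv ^^ p) (f n) x\<bar> \<le> A" and B: "\<And>x. \<bar>(deriv ^^ q) (g n) x\<bar> \<le> B"
      unfolding f_def g_def using bump_space_bounded[OF higher_deriv_bump_space] by metis
    have "\<bar>F n p q x\<bar> \<le> A * B" for x
      unfolding F_def abs_mult by (intro mult_mono A B) (use A[of 0] in auto)
    then show ?thesis by blast
  qed
  then have "\<exists>c>0. \<forall>p\<le>n. \<forall>q\<le>n. \<forall>x. \<bar>c * F n p q x\<bar> \<le> (1 / 2) ^ n" for n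
    by (rule uniform_weight)
  then obtain c where c: "\<And>n. c n > 0"
    "\<And>n p q x. p \<le> n \<Longrightarrow> q \<le> n \<Longrightarrow> \<bar>c n * F n p q x\<bar> \<le> (1 / 2) ^ n" by metis
  define S where "S p q x = (\<Sum>n. c n * F n p q x)" for p q x
  \<comment> \<open>The bound starts at \<open>n = max p q\<close>, hence the eventual form of the
    Weierstrass test.\<close>
  have ev: "\<forall>\<^sub>F n in sequentially. \<forall>x\<in>X. norm (c n * F n p q x) \<le> (1 / 2) ^ n" for p q X
    using eventually_ge_at_top[of "max p q"] by eventually_elim (use c in auto)
  have geom: "summable (\<lambda>n. (1 / 2 :: real) ^ n)" by (rule summable_geometric) simp
  have unif: "uniform_limit X (\<lambda>n x. \<Sum>i<n. c i * F i p q x) (S p q) sequentially" for p q X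
    unfolding S_def[abs_def] by (rule Weierstrass_m_test_ev[OF ev geom])
  have summ: "summable (\<lambda>n. c n * F n p q x)" for p q x
    by (rule summable_comparison_test_ev[OF _ geom]) (use ev[of "{x}" p q] in simp)
  have cont: "continuous_on UNIV (S p q)" for p q
  proof (rule uniform_limit_theorem[OF _ unif])
    have D: "continuous_on UNIV ((deriv ^^ k) (bump a b))" for k a b
      by (rule DERIV_continuous_on) (rule has_field_derivative_at_within[OF higher_deriv_bump])
    have "continuous_on UNIV (F n p q)" for n
      unfolding F_def f_def g_def
      by (intro continuous_on_mult continuous_on_compose2[OF D _ subset_UNIV]
          continuous_on_fst continuous_on_snd continuous_on_id)
    then show "\<forall>\<^sub>F n in sequentially. continuous_on UNIV (\<lambda>x. \<Sum>i<n. c i * F i p q x)"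
      by (intro always_eventually allI continuous_on_sum continuous_on_mult continuous_on_const)
  qed simp
  \<comment> \<open>Termwise differentiation along a horizontal line: uniform convergence of the
    differentiated series on the plane is pulled back along
    \<open>\<lambda>x. (x, r)\<close>.\<close>
  have dv: "((\<lambda>x. S p q (x, r)) has_real_derivative S (Suc p) q (v, r)) (at v)" for p q v r
    unfolding S_def
  proof (rule has_field_derivative_series'(2)[where S = UNIV and ?x0.0 = 0
        and f = "\<lambda>n x. c n * F n p q (x, r)" and f' = "\<lambda>n x. c n * F n (Suc p) q (x, r)"])
    show "uniformly_convergent_on UNIV (\<lambda>n x. \<Sum>i<n. c i * F i (Suc p) q (x, r))"
      using uniform_limit_compose'[OF unif[where X = UNIV and p = "Suc p" and q = q], of "\<lambda>x. (x, r)" UNIV]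
      by (auto simp: uniformly_convergent_on_def)
    show "((\<lambda>x. c n * F n p q (x, r)) has_real_derivative c n * F n (Suc p) q (x, r))
        (at x within UNIV)" for n x
      unfolding F_def f_def using higher_deriv_bump[of p _ _ x]
      by (auto intro!: derivative_eq_intros simp del: funpow.simps)
  qed (use summ in auto)
  have dr: "((\<lambda>y. S p q (v, y)) has_real_derivative S p (Suc q) (v, r)) (at r)" for p q v r
    unfolding S_def
  proof (rule has_field_derivative_series'(2)[where S = UNIV and ?x0.0 = 0
        and f = "\<lambda>n y. c n * F n p q (v, y)" and f' = "\<lambda>n y. c n * F n p (Suc q) (v, y)"])
    show "uniformly_convergent_on UNIV (\<lambda>n y. \<Sum>i<n. c i * F i p (Suc q) (v, y))"
      using uniform_limit_compose'[OF unif[where X = UNIV and p = p and q = "Suc q"], of "\<lambda>y. (v, y)" UNIV]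
      by (auto simp: uniformly_convergent_on_def)
    show "((\<lambda>y. c n * F n p q (v, y)) has_real_derivative c n * F n p (Suc q) (v, y))
        (at y within UNIV)" for n y
      unfolding F_def g_def using higher_deriv_bump[of q _ _ y]
      by (auto intro!: derivative_eq_intros simp del: funpow.simps)
  qed (use summ in auto)
  have mem_box: "x \<in> box (a n) (b n) \<longleftrightarrow>
      fst x \<in> {fst (a n)<..<fst (b n)} \<and> snd x \<in> {snd (a n)<..<snd (b n)}" for x n
    by (subst box_prod) (auto simp: mem_Times_iff box_real)
  \<comment> \<open>Outside the box some coordinate leaves its interval, where the corresponding
    bump vanishes with all its derivatives.\<close>
  have F0: "F n p q x = 0" if "x \<notin> box (a n) (b n)" for n p q x
    using that bump_space_eq_0[OF higher_deriv_bump_space]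
    unfolding F_def f_def g_def mem_box by (metis mult_eq_0_iff)
  have Fpos: "F n 0 0 x > 0" if "x \<in> box (a n) (b n)" for n x
    using that bump_pos unfolding F_def f_def g_def mem_box by simp
  show thesis
  proof (rule that)
    show "smooth_on_plane UNIV (S 0 0)" by (rule smooth_of_all_partials[of S, OF cont dv dr])
    show "(partial_v ^^ p) ((partial_r ^^ q) (S 0 0)) x = 0" if "x \<in> Z" for p q x
    proof -
      have "x \<notin> box (a n) (b n)" for n using Un that by blast
      then have "S p q x = 0" by (simp add: S_def F0)
      then show ?thesis by (simp add: smooth_of_all_partials(2)[of S, OF cont dv dr])
    qed
    show "S 0 0 x > 0" if "x \<notin> Z" for x
    proof -
      \<comment> \<open>Some box contains \<open>x\<close> and contributes a positive term; all
        other terms are nonnegative, so nothing cancels it.\<close>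
      have "x \<in> (\<Union>n. box (a n) (b n))" using Un that by simp
      then obtain m where m: "x \<in> box (a m) (b m)" by (elim UN_E)
      have "c n * F n 0 0 x \<ge> 0" for n
        using c(1)[of n] F0[of x n 0 0] Fpos[of x n] by (cases "x \<in> box (a n) (b n)") auto
      then show ?thesis unfolding S_def
        using suminf_pos2[OF summ, of 0 0 x m] c(1) Fpos[OF m] by simp
    qed
  qed
qed

text \<open>A locally compact \<open>S\<close> is open in its closure, so an open \<open>W\<close>
  inside the closure that meets \<open>S\<close> would give a nonempty open subset of
  \<open>S\<close>, contradicting measure zero. Measure zero alone would not do: a countable dense
  set is null.\<close>

lemma open_not_subset_closure_locally_compact_negligible:
  fixes S :: "'a::euclidean_space set"
  assumes "locally compact S" "negligible S" "open W" "W \<inter> S \<noteq> {}"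
  shows "\<not> W \<subseteq> closure S"
proof
  assume W: "W \<subseteq> closure S"
  obtain T where T: "open T" "S = T \<inter> closure S"
    using locally_compact_open_Int_closure[OF assms(1)] by blast
  have "T \<inter> W \<subseteq> S" "T \<inter> W \<noteq> {}" using T W assms(4) by auto
  then show False
    using open_not_negligible[of "T \<inter> W"] T assms by (metis negligible_subset open_Int)
qed

section \<open>Perturbing the mass function away from the curve\<close>

theorem proposition1:
  fixes I :: "real set" and T R :: "real \<Rightarrow> real" and \<Sigma> :: "(real \<times> real) set"
    and N :: nat and U :: "(real \<times> real) set" and M :: "real \<times> real \<Rightarrow> real"
  assumes "open I" and "is_interval I" and "I \<noteq> {}"
    and "smooth_embedded_curve I T R"
    and "\<Sigma> = (\<lambda>t. (T t, R t)) ` I"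
    and "open U" and "\<Sigma> \<subseteq> U" and "smooth_on_plane U M"
  shows "\<exists>U' M'. open U' \<and> \<Sigma> \<subseteq> U' \<and> smooth_on_plane U' M' \<and>
           (\<forall>p q. p + q \<le> N \<longrightarrow>
              (\<forall>x\<in>\<Sigma>. (partial_v ^^ p) ((partial_r ^^ q) M') x =
                      (partial_v ^^ p) ((partial_r ^^ q) M) x)) \<and>
           (\<forall>W. \<Sigma> \<subseteq> interior W \<and> W \<subseteq> U \<inter> U' \<longrightarrow> (\<exists>x\<in>W. M' x \<noteq> M x))"
proof -
  have emb: "embedding_map (top_of_set I) euclidean (\<lambda>t. (T t, R t))"
    and T: "smooth_on_line I T" and R: "smooth_on_line I R"
    using assms(4) by (auto simp: smooth_embedded_curve_def)
  have "I homeomorphic \<Sigma>"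
  proof -
    obtain g where "homeomorphic_maps (top_of_set I) (top_of_set \<Sigma>) (\<lambda>t. (T t, R t)) g"
      using emb assms(5) by (auto simp: embedding_map_def homeomorphic_map_maps)
    then have "homeomorphism I \<Sigma> (\<lambda>t. (T t, R t)) g"
      by (intro homeomorphismI) (simp_all add: homeomorphic_maps_def image_subset_iff_funcset)
    then show ?thesis by (auto simp: homeomorphic_def)
  qed
  then have lc: "locally compact \<Sigma>"
    using open_imp_locally_compact[OF assms(1)] homeomorphic_local_compactness by blast
  have "(\<lambda>t. (T t, R t)) differentiable_on I"
  proof -
    have "T differentiable at t" "R differentiable at t" if "t \<in> I" for t
      using T R that unfolding smooth_on_line_def by (metis funpow_0)+
    then show ?thesis
      by (auto simp: differentiable_on_def intro!: differentiable_Pair intro: differentiable_at_withinI)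
  qed
  \<comment> \<open>A differentiable image of a subset of the line is null in the plane, by
    comparison of dimensions.\<close>
  then have "negligible \<Sigma>"
    unfolding assms(5) by (rule negligible_differentiable_image_lowdim[rotated]) simp
  note not_dense = open_not_subset_closure_locally_compact_negligible[OF lc this]
  \<comment> \<open>The curve need not be closed in the plane, so the flat function is built for its
    closure.\<close>
  obtain h where h: "smooth_on_plane UNIV h" "\<And>x. x \<notin> closure \<Sigma> \<Longrightarrow> h x > 0"
    "\<And>p q x. x \<in> closure \<Sigma> \<Longrightarrow> (partial_v ^^ p) ((partial_r ^^ q) h) x = 0"
    using flat_function_exists[OF closed_closure] by blast
  have hU: "smooth_on_plane U h"
    using h(1) Ck_on_subset[OF _ subset_UNIV] by (simp add: smooth_on_plane_def)
  show ?thesis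
  proof (intro exI conjI allI impI ballI)
    \<comment> \<open>This fixes the witnesses: \<open>U\<close> itself as the new domain and
      \<open>M + h\<close> as the new function. As \<open>h\<close> is flat to every order on the
      curve, the same witnesses serve every \<open>N\<close>.\<close>
    show "smooth_on_plane U (\<lambda>x. M x + h x)"
      using hU assms(6,8) Ck_on_add by (auto simp: smooth_on_plane_def)
    show "(partial_v ^^ p) ((partial_r ^^ q) (\<lambda>x. M x + h x)) x =
        (partial_v ^^ p) ((partial_r ^^ q) M) x" if "x \<in> \<Sigma>" for p q x
    proof -
      have "(partial_v ^^ p) ((partial_r ^^ q) (\<lambda>x. M x + h x)) x =
          (partial_v ^^ p) ((partial_r ^^ q) M) x + (partial_v ^^ p) ((partial_r ^^ q) h) x"
        using that assms(6-8) hU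
        by (intro funpow_partial_add(1)[where U = U] funpow_partial_add(2)[where U = U]
            smooth_on_plane_funpow) auto
      moreover have "x \<in> closure \<Sigma>" using that closure_subset by blast
      ultimately show ?thesis by (simp add: h(3))
    qed
    fix W assume W: "\<Sigma> \<subseteq> interior W \<and> W \<subseteq> U \<inter> U"
    \<comment> \<open>As \<open>I\<close> is nonempty, the open set \<open>interior W\<close> meets
      the curve and must therefore leave its closure, at a point where \<open>h\<close> is
      positive.\<close>
    then have "interior W \<inter> \<Sigma> \<noteq> {}" using assms(3,5) by auto
    then obtain x where "x \<in> interior W" "x \<notin> closure \<Sigma>"
      using not_dense[of "interior W"] by auto
    then show "\<exists>x\<in>W. M x + h x \<noteq> M x"
      using h(2)[of x] interior_subset[of W] by (intro bexI[of _ x]) auto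
  qed (use assms in auto)
qed

end
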